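(* Let $f$ be meromorphic in the open unit disk $\mathbb{D}$. Then $$\inf_{z\in\mathbb{D}} f^\#(z)\le\frac12,$$ and equality holds if and only if $f$ is (the restriction to $\mathbb{D}$ of) a rigid motion of the Riemann sphere.
   Context: $\mathbb{D}=\{z\in\mathbb{C}:|z|<1\}$. The spherical derivative of a meromorphic function $f$ is $f^\#:=\frac{|f'|}{1+|f|^2}$, extended continuously to the poles of $f$ (equivalently, $f^\#(z_0)=(1/f)^\#(z_0)$ at a pole $z_0$). A rigid motion of the Riemann sphere is a Möbius transformation of the form $T(z)=\frac{az+b}{cz+d}$ such that the matrix $\begin{pmatrix} a&b\\ c&d\end{pmatrix}$ is unitary. *)

theory Defs
  imports "HOL-Complex_Analysis.Complex_Analysis"
begin

text \<open>
  A meromorphic function is represented by a function that is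
  \<^const>\<open>nicely_meromorphic_on\<close> its domain: removable singularities are removed, and the
  value stored at a pole is the dummy value 0, standing for the point at infinity of the sphere.
\<close>

text \<open>
  The value at a pole is the continuous extension; the limit exists there by
  \<open>spherical_deriv_tendsto_pole\<close> below.
\<close>

definition spherical_deriv :: "(complex \<Rightarrow> complex) \<Rightarrow> complex \<Rightarrow> real" where
  "spherical_deriv f z =
     (if is_pole f z
      then Lim (at z) (\<lambda>w. norm (deriv f w) / (1 + (norm (f w))\<^sup>2))
      else norm (deriv f z) / (1 + (norm (f z))\<^sup>2))"

definition conj_transpose :: "complex^'n^'m \<Rightarrow> complex^'m^'n" where
  "conj_transpose A = (\<chi> i j. cnj (A $ j $ i))"

definition unitary_matrix :: "complex^'n^'n \<Rightarrow> bool" where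
  "unitary_matrix A \<longleftrightarrow> conj_transpose A ** A = mat 1 \<and> A ** conj_transpose A = mat 1"

text \<open>
  At a zero of the denominator, division by zero gives the value 0, which is the same dummy value
  for the point at infinity as in \<^const>\<open>nicely_meromorphic_on\<close>.
\<close>

definition rigid_motion :: "(complex \<Rightarrow> complex) \<Rightarrow> bool" where
  "rigid_motion T \<longleftrightarrow>
     (\<exists>a b c d. unitary_matrix (vector [vector [a, b], vector [c, d]] :: complex^2^2) \<and>
        (\<forall>z. T z = (a * z + b) / (c * z + d)))"

lemma spherical_deriv_tendsto_pole:
  assumes mero: "f nicely_meromorphic_on {z}" and pole: "is_pole f z"
  shows "((\<lambda>w. norm (deriv f w) / (1 + (norm (f w))\<^sup>2)) \<longlongrightarrow> 
           spherical_deriv (\<lambda>w. 1 / f w) z) (at z)"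
    and "spherical_deriv f z = spherical_deriv (\<lambda>w. 1 / f w) z"
proof -
  define g where "g = (\<lambda>w. 1 / f w)"
  have f0: "f z = 0"
    using mero pole unfolding nicely_meromorphic_on_def
    by (metis at_neq_bot insertI1 is_pole_def not_tendsto_and_filterlim_at_infinity)
  have g0: "g z = 0"
    by (simp add: g_def f0)
  have g_lim: "g \<midarrow>z\<rightarrow> 0"
    using tendsto_inverse_0[THEN filterlim_compose, OF pole[unfolded is_pole_def]]
    by (simp add: g_def inverse_eq_divide)
  have mf: "f meromorphic_on {z}"
    using mero by (simp add: nicely_meromorphic_on_def)
  then have "g meromorphic_on {z}"
    unfolding g_def by (intro meromorphic_intros)
  then have g_an: "g analytic_on {z}"
    using g_lim g0 nicely_meromorphic_on_imp_analytic_at[of g "{z}" z]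
    by (auto simp: nicely_meromorphic_on_def is_pole_def
        dest: not_tendsto_and_filterlim_at_infinity[OF at_neq_bot])
  have g_not_pole: "\<not> is_pole g z"
    using g_lim not_tendsto_and_filterlim_at_infinity[OF at_neq_bot]
    unfolding is_pole_def by blast
  let ?S = "\<lambda>h w. norm (deriv h w) / (1 + (norm (h w))\<^sup>2) :: real"
  have "isCont g z" "isCont (deriv g) z"
    using g_an analytic_deriv[OF g_an] by (auto intro: analytic_at_imp_isCont)
  then have "isCont (?S g) z"
    by (intro continuous_intros) (auto simp: add_nonneg_eq_0_iff)
  then have lim: "(?S g) \<midarrow>z\<rightarrow> ?S g z"
    by (simp add: isCont_def)
  have "\<forall>\<^sub>F w in at z. f w \<noteq> 0"
    using pole by (rule non_zero_neighbour_pole)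
  moreover have "\<forall>\<^sub>F w in at z. f analytic_on {w}"
  proof -
    obtain r where r: "r > 0" "f analytic_on ball z r - {z}"
      using mf by (auto simp: meromorphic_at_iff isolated_singularity_at_def)
    have "\<forall>\<^sub>F w in at z. w \<in> ball z r - {z}"
      using r(1) by (intro eventually_at_in_open) auto
    then show ?thesis
      by eventually_elim (use r(2) in \<open>auto intro: analytic_on_subset\<close>)
  qed
  ultimately have "\<forall>\<^sub>F w in at z. ?S g w = ?S f w"
  proof eventually_elim
    case (elim w)
    then have "(f has_field_derivative deriv f w) (at w)"
      by (meson analytic_on_imp_differentiable_at DERIV_deriv_iff_field_differentiable insertI1)
    then have "(g has_field_derivative - deriv f w / (f w)\<^sup>2) (at w)"
      unfolding g_def using elim(1) 
      by (auto intro!: derivative_eq_intros simp: power2_eq_square field_simps)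
    then have dg: "deriv g w = - deriv f w / (f w)\<^sup>2"
      by (rule DERIV_imp_deriv)
    define d n where "d = norm (deriv f w)" and "n = norm (f w)"
    have n: "n > 0"
      using elim(1) by (simp add: n_def)
    have "norm (deriv g w) = d / n\<^sup>2" "norm (g w) = 1 / n"
      unfolding dg by (simp_all add: g_def d_def n_def norm_divide norm_power)
    moreover have "d / n\<^sup>2 / (1 + (1 / n)\<^sup>2) = d / (1 + n\<^sup>2)"
    proof -
      have "n\<^sup>2 * (1 + (1 / n)\<^sup>2) = 1 + n\<^sup>2"
        using n by (simp add: power2_eq_square algebra_simps)
      then show ?thesis
        by simp
    qed
    ultimately show ?case
      by (simp add: d_def n_def)
  qed
  with lim have *: "(?S f) \<midarrow>z\<rightarrow> ?S g z"
    using tendsto_cong by force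
  then show "?S f \<midarrow>z\<rightarrow> spherical_deriv (\<lambda>w. 1 / f w) z"
    using g_not_pole by (simp add: spherical_deriv_def g_def)
  have "spherical_deriv f z = ?S g z"
    using pole tendsto_Lim[OF at_neq_bot *] by (simp add: spherical_deriv_def)
  then show "spherical_deriv f z = spherical_deriv (\<lambda>w. 1 / f w) z"
    using g_not_pole by (simp add: spherical_deriv_def g_def)
qed

end

theory Submission
  imports Defs
begin

text \<open>
  Suppose that the spherical derivative of \<open>f\<close> is at least \<open>c > 0\<close>. On every disc of radius \<open>r < 1\<close>
  the function \<open>f\<close> is a quotient \<open>w1 / w2\<close> of holomorphic functions without common zeros whose
  Wronskian \<open>w1' w2 - w1 w2'\<close> is 1 (\<open>normalized_quotient_exists\<close>): in any such representation
  \<open>f = A / P\<close> the Wronskian has no zeros, since the spherical derivative is its modulus divided by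
  \<open>|A|\<^sup>2 + |P|\<^sup>2\<close> (\<open>spherical_deriv_quotient\<close>), and one divides by its square root. For the
  normalized pair the spherical derivative is \<open>1 / (|w1|\<^sup>2 + |w2|\<^sup>2)\<close>, so that
  \<open>|w1|\<^sup>2 + |w2|\<^sup>2 \<le> 1 / c\<close>.

  Let \<open>a j\<close> and \<open>b j\<close> be the Taylor coefficients of \<open>w1\<close> and \<open>w2\<close> at 0. Averaging over the circle of
  radius \<open>s < r\<close> bounds the sum of \<open>(|a j|\<^sup>2 + |b j|\<^sup>2) s\<^sup>2\<^sup>j\<close> over any finite set of indices by
  \<open>1 / c\<close> (\<open>normalized_quotient_taylor_bound\<close>). The Wronskian at 0 is \<open>a 1 b 0 - a 0 b 1 = 1\<close>, so by the
  Cauchy-Schwarz inequality the vectors \<open>(a 0, b 0)\<close> and \<open>(a 1, b 1)\<close> have norms with product at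
  least 1, and the indices 0 and 1 alone contribute at least \<open>2 s\<close>. Letting \<open>s\<close> tend to 1 gives
  \<open>c \<le> 1 / 2\<close>.

  If \<open>c = 1 / 2\<close>, then there is equality everywhere: all other coefficients vanish, and
  \<open>(a 0, b 0)\<close> and \<open>(a 1, b 1)\<close> are orthonormal, so \<open>f z = (a 1 z + a 0) / (b 1 z + b 0)\<close> is a rigid
  motion (\<open>rigid_motion_if_spherical_deriv_ge_half\<close>). Conversely, a rigid motion has the spherical
  derivative \<open>1 / (1 + |z|\<^sup>2)\<close> (\<open>spherical_deriv_rigid_motion\<close>), which exceeds \<open>1 / 2\<close> in the disc.
\<close>

section \<open>Taylor coefficients and means over circles\<close>

definition taylor_coeff :: "(complex \<Rightarrow> complex) \<Rightarrow> nat \<Rightarrow> complex" where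
  "taylor_coeff f n = (deriv ^^ n) f 0 / fact n"

lemma taylor_coeff_power: "taylor_coeff (\<lambda>z. z ^ m) n = (if n = m then 1 else 0)"
proof -
  have "taylor_coeff (\<lambda>z. z ^ m) n
      = pochhammer (of_nat (Suc m - n)) n * 0 ^ (m - n) / fact n"
    using higher_deriv_power[of n 0 m 0] by (simp add: taylor_coeff_def)
  also have "\<dots> = (if n = m then 1 else 0)"
    by (cases n m rule: linorder_cases) (auto simp: pochhammer_0_left pochhammer_fact[symmetric])
  finally show ?thesis .
qed

lemma taylor_coeff_cong_cmult:
  assumes "r > 0" "f holomorphic_on ball 0 r" "\<And>z. z \<in> ball 0 r \<Longrightarrow> g z = \<epsilon> * f z"
  shows "taylor_coeff g n = \<epsilon> * taylor_coeff f n"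
proof -
  have "(deriv ^^ n) g 0 = (deriv ^^ n) (\<lambda>z. \<epsilon> * f z) 0"
    using assms by (intro higher_deriv_cong_ev refl
        eventually_mono[OF eventually_nhds_in_open[of "ball 0 r" 0]]) auto
  also have "\<dots> = \<epsilon> * (deriv ^^ n) f 0"
    using assms by (intro higher_deriv_cmult[of f "ball 0 r"]) auto
  finally show ?thesis by (simp add: taylor_coeff_def)
qed

lemma holomorphic_eq_affine:
  assumes "f holomorphic_on ball 0 r" "z \<in> ball 0 r"
    and "\<And>n. n \<ge> 2 \<Longrightarrow> taylor_coeff f n = 0"
  shows "f z = taylor_coeff f 1 * z + taylor_coeff f 0"
proof -
  have "(\<lambda>n. taylor_coeff f n * z ^ n) sums f z"
    using holomorphic_power_series[OF assms(1,2)] by (simp add: taylor_coeff_def)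
  moreover have "(\<lambda>n. taylor_coeff f n * z ^ n) sums (\<Sum>n\<in>{0,1}. taylor_coeff f n * z ^ n)"
  proof (rule sums_finite)
    fix n :: nat assume "n \<notin> {0, 1}"
    then have "n \<ge> 2" by auto
    then show "taylor_coeff f n * z ^ n = 0" by (simp add: assms(3))
  qed auto
  ultimately have "f z = (\<Sum>n\<in>{0,1}. taylor_coeff f n * z ^ n)"
    by (rule sums_unique2)
  then show ?thesis by simp
qed

text \<open>
  Cauchy's formula for the derivatives at the centre, read as the computation of a Fourier
  coefficient. For powers of \<open>z\<close> it also provides the orthonormality of the characters of the
  circle.
\<close>
lemma has_integral_taylor_coeff:
  assumes "f holomorphic_on ball 0 r" "0 < s" "s < r"
  shows "((\<lambda>t. f (of_real s * cis (2 * pi * t)) * cnj (cis (2 * pi * t)) ^ n)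
           has_integral taylor_coeff f n * of_real s ^ n) {0..1}"
proof -
  define e where "e = (\<lambda>t. cis (2 * pi * t))"
  have e: "exp (2 * of_real pi * \<i> * of_real t) = e t" for t :: real
    by (simp add: e_def cis_conv_exp mult_ac)
  have e0: "e t \<noteq> 0" for t by (simp add: e_def)
  have cont: "continuous_on (cball 0 s) f" "f holomorphic_on ball 0 s"
    using assms by (auto intro!: holomorphic_on_imp_continuous_on intro: holomorphic_on_subset)
  have "((\<lambda>u. f u / (u - 0) ^ Suc n) has_contour_integral
           (2 * pi * \<i> / fact n * (deriv ^^ n) f 0)) (circlepath 0 s)"
    using assms by (intro Cauchy_has_contour_integral_higher_derivative_circlepath cont) auto
  then have "((\<lambda>t. f (of_real s * e t) / (of_real s * e t) ^ Suc n * (2 * pi * \<i> * s * e t))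
              has_integral 2 * pi * \<i> / fact n * (deriv ^^ n) f 0) {0..1}"
    unfolding has_contour_integral vector_derivative_circlepath unfolding circlepath
    by (simp add: e)
  from has_integral_mult_right[OF this, of "of_real s ^ n / (2 * pi * \<i>)"]
  have "((\<lambda>t. f (of_real s * e t) * cnj (e t) ^ n)
           has_integral taylor_coeff f n * of_real s ^ n) {0..1}"
  proof (rule has_integral_eq_rhs[OF has_integral_eq, rotated])
    fix t :: real
    have "e t ^ n * cnj (e t) ^ n = 1"
      by (simp add: e_def cis_cnj cis_mult power_mult_distrib[symmetric] del: complex_cnj_power)
    then have "cnj (e t) ^ n = 1 / e t ^ n"
      using e0[of t] by (simp add: field_simps del: complex_cnj_power)
    then show "of_real s ^ n / (2 * pi * \<i>) *
          (f (of_real s * e t) / (of_real s * e t) ^ Suc n * (2 * pi * \<i> * s * e t))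
        = f (of_real s * e t) * cnj (e t) ^ n"
      using assms(2) e0[of t] by (simp add: power_mult_distrib field_simps del: complex_cnj_power)
  qed (simp add: taylor_coeff_def field_simps)
  then show ?thesis by (simp only: e_def)
qed

lemma integrable_norm_power2_circle:
  assumes f: "f holomorphic_on ball 0 r" and s: "0 < s" "s < r"
  shows "(\<lambda>t. (norm (f (of_real s * cis (2 * pi * t))))\<^sup>2) integrable_on {0..1}"
proof -
  have "continuous_on {0..1} (\<lambda>t. cis (2 * pi * t))"
    by (intro continuous_intros)
  moreover have "(\<lambda>t. of_real s * cis (2 * pi * t)) ` {0..1} \<subseteq> ball 0 r"
    using s by (auto simp: norm_mult)
  ultimately show ?thesis
    by (intro integrable_continuous_real continuous_intros
        continuous_on_compose2[OF holomorphic_on_imp_continuous_on[OF f]]) auto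
qed

text \<open>
  Let \<open>F\<close> be the restriction of \<open>f\<close> to the circle and \<open>p\<close> its projection to the span of the
  characters in \<open>J\<close>. Then \<open>F\<close> and \<open>p\<close> have the same inner product with \<open>p\<close>, so integrating the
  pointwise bound \<open>2 Re (F cnj p) - |p|\<^sup>2 \<le> |F|\<^sup>2\<close> leaves the square norm of \<open>p\<close> on the left.
\<close>
lemma bessel_inequality_circle:
  assumes f: "f holomorphic_on ball 0 r" and s: "0 < s" "s < r" and J: "finite J"
  shows "(\<Sum>j\<in>J. (norm (taylor_coeff f j))\<^sup>2 * s ^ (2 * j))
           \<le> integral {0..1} (\<lambda>t. (norm (f (of_real s * cis (2 * pi * t))))\<^sup>2)"
proof -
  define e where "e = (\<lambda>t. cis (2 * pi * t))"
  define c where "c = (\<lambda>j. taylor_coeff f j * of_real s ^ j)"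
  define p where "p = (\<lambda>t. \<Sum>j\<in>J. c j * e t ^ j)"
  let ?F = "\<lambda>t. f (of_real s * e t)"
  have cnj_p: "cnj (p t) = (\<Sum>j\<in>J. cnj (c j) * cnj (e t) ^ j)" for t
    by (simp add: p_def)
  have fp: "((\<lambda>t. ?F t * cnj (p t)) has_integral (\<Sum>j\<in>J. cnj (c j) * c j)) {0..1}"
  proof -
    have "((\<lambda>t. \<Sum>j\<in>J. cnj (c j) * (?F t * cnj (e t) ^ j)) has_integral (\<Sum>j\<in>J. cnj (c j) * c j)) {0..1}"
      unfolding c_def e_def
      by (intro has_integral_sum J has_integral_mult_right has_integral_taylor_coeff[OF f s])
    then show ?thesis by (simp add: cnj_p sum_distrib_left mult_ac)
  qed
  have pe: "((\<lambda>t. p t * cnj (e t) ^ k) has_integral (if k \<in> J then c k else 0)) {0..1}" for k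
  proof -
    have *: "((\<lambda>t. e t ^ j * cnj (e t) ^ k) has_integral (if k = j then 1 else 0)) {0..1}" for j
      using has_integral_taylor_coeff[of "\<lambda>z. z ^ j" 2 1 k]
      by (simp add: taylor_coeff_power e_def holomorphic_intros)
    have "((\<lambda>t. \<Sum>j\<in>J. c j * (e t ^ j * cnj (e t) ^ k)) has_integral
             (\<Sum>j\<in>J. c j * (if k = j then 1 else 0))) {0..1}"
      by (intro has_integral_sum J has_integral_mult_right *)
    moreover have "(\<Sum>j\<in>J. c j * (if k = j then 1 else 0)) = (if k \<in> J then c k else 0)"
      using J by (simp add: if_distrib cong: if_cong)
    moreover have "(\<Sum>j\<in>J. c j * (e t ^ j * cnj (e t) ^ k)) = p t * cnj (e t) ^ k" for t
      by (simp add: p_def sum_distrib_right mult.assoc)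
    ultimately show ?thesis by (simp del: complex_cnj_power)
  qed
  have pp: "((\<lambda>t. p t * cnj (p t)) has_integral (\<Sum>j\<in>J. cnj (c j) * c j)) {0..1}"
  proof -
    have "((\<lambda>t. \<Sum>j\<in>J. cnj (c j) * (p t * cnj (e t) ^ j)) has_integral
            (\<Sum>j\<in>J. cnj (c j) * (if j \<in> J then c j else 0))) {0..1}"
      by (intro has_integral_sum J has_integral_mult_right pe)
    then show ?thesis by (simp add: cnj_p sum_distrib_left mult_ac cong: sum.cong)
  qed
  have "((\<lambda>t. Re (2 * (?F t * cnj (p t)) - p t * cnj (p t))) has_integral
           Re (2 * (\<Sum>j\<in>J. cnj (c j) * c j) - (\<Sum>j\<in>J. cnj (c j) * c j))) {0..1}"
    by (intro has_integral_Re has_integral_diff has_integral_mult_right fp pp)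
  also have "Re (2 * (\<Sum>j\<in>J. cnj (c j) * c j) - (\<Sum>j\<in>J. cnj (c j) * c j))
      = (\<Sum>j\<in>J. (norm (taylor_coeff f j))\<^sup>2 * s ^ (2 * j))"
  proof -
    have "Re (cnj (c j) * c j) = (norm (taylor_coeff f j))\<^sup>2 * s ^ (2 * j)" for j
    proof -
      have "Re (cnj (c j) * c j) = (norm (c j))\<^sup>2"
        by (metis complex_norm_square mult.commute Re_complex_of_real)
      then show ?thesis using s
        by (simp add: c_def norm_mult norm_power power_mult_distrib power_mult[symmetric] mult.commute)
    qed
    then show ?thesis by (simp add: Re_sum[symmetric])
  qed
  finally have lower: "((\<lambda>t. Re (2 * (?F t * cnj (p t)) - p t * cnj (p t))) has_integral
      (\<Sum>j\<in>J. (norm (taylor_coeff f j))\<^sup>2 * s ^ (2 * j))) {0..1}" .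
  have upper: "((\<lambda>t. (norm (?F t))\<^sup>2) has_integral integral {0..1} (\<lambda>t. (norm (?F t))\<^sup>2)) {0..1}"
    unfolding e_def by (intro integrable_integral integrable_norm_power2_circle[OF f s])
  \<comment> \<open>This is \<open>|F - p|\<^sup>2 \<ge> 0\<close>, expanded.\<close>
  have "Re (2 * (?F t * cnj (p t)) - p t * cnj (p t)) \<le> (norm (?F t))\<^sup>2" for t
  proof -
    have "0 \<le> (norm (?F t - p t))\<^sup>2" by simp
    then show ?thesis
      unfolding cmod_power2 by (simp add: power2_eq_square algebra_simps)
  qed
  then show ?thesis
    using has_integral_le[OF lower upper] by (simp add: e_def)
qed

text \<open>
  The ring of holomorphic functions on a connected open set has no zero divisors: where one factor
  does not vanish, the other one vanishes on an open set.
\<close>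
lemma holomorphic_mult_eq_0:
  assumes f: "f holomorphic_on S" and g: "g holomorphic_on S" and S: "open S" "connected S"
    and fg: "\<And>z. z \<in> S \<Longrightarrow> f z * g z = 0"
  shows "(\<forall>z\<in>S. f z = 0) \<or> (\<forall>z\<in>S. g z = 0)"
proof (rule disjCI)
  assume "\<not> (\<forall>z\<in>S. g z = 0)"
  then obtain z0 where z0: "z0 \<in> S" "g z0 \<noteq> 0" by blast
  let ?U = "{z\<in>S. g z \<noteq> 0}"
  have "open ?U"
    using continuous_open_preimage[OF holomorphic_on_imp_continuous_on[OF g] S(1), of "- {0}"]
    by (simp add: vimage_def Int_def open_Compl)
  then show "\<forall>z\<in>S. f z = 0"
    using analytic_continuation_open[of ?U S f "\<lambda>_. 0"] z0 S f fg
    by (fastforce intro: holomorphic_intros)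
qed

section \<open>The spherical derivative of a quotient of holomorphic functions\<close>

lemma spherical_deriv_nonneg:
  assumes "f nicely_meromorphic_on {z}"
  shows "spherical_deriv f z \<ge> 0"
proof (cases "is_pole f z")
  case True
  show ?thesis
    unfolding spherical_deriv_tendsto_pole(2)[OF assms True]
    by (rule tendsto_lowerbound[OF spherical_deriv_tendsto_pole(1)[OF assms True]]) auto
qed (simp add: spherical_deriv_def)

text \<open>
  The strictly smaller disc is needed for Weierstrass factorization: zeros and poles of \<open>f\<close> might
  accumulate at the unit circle, but not at a circle inside the unit disc.
\<close>
lemma nicely_meromorphic_quotient_on_smaller_disc:
  assumes f: "f nicely_meromorphic_on ball 0 1" and r: "r < 1"
  obtains A P where "A holomorphic_on ball 0 r" "P holomorphic_on ball 0 r"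
    "\<And>z. z \<in> ball 0 r \<Longrightarrow> f z = A z / P z"
    "\<And>z. z \<in> ball 0 r \<Longrightarrow> A z \<noteq> 0 \<or> P z \<noteq> 0"
    "\<And>z. z \<in> ball 0 r \<Longrightarrow> P z = 0 \<longleftrightarrow> is_pole f z"
proof (cases "\<forall>z\<in>ball 0 1. f z = 0")
  case True
  have "\<not> is_pole f z" if "z \<in> ball 0 1" for z
  proof -
    have "eventually (\<lambda>w. w \<in> ball 0 1) (at z)"
      using that by (intro eventually_at_in_open') auto
    then have "\<forall>\<^sub>F w in at z. f w = 0"
      by eventually_elim (use True in auto)
    then have "is_pole f z \<longleftrightarrow> is_pole (\<lambda>_. 0 :: complex) z"
      by (intro is_pole_cong) auto
    then show ?thesis by simp
  qed
  then show ?thesis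
    using True r by (intro that[of "\<lambda>_. 0" "\<lambda>_. 1"]) (auto intro!: holomorphic_intros)
next
  case False
  have "\<forall>\<^sub>F z in cosparse (ball 0 1). f z \<noteq> 0"
    using nicely_meromorphic_imp_constant_or_avoid[OF f, of 0] False by auto
  moreover have "\<forall>\<^sub>F z in cosparse (ball 0 1). \<not> is_pole f z"
    using f by (intro meromorphic_on_imp_not_pole_cosparse) (simp add: nicely_meromorphic_on_def)
  ultimately have "\<forall>\<^sub>F z in cosparse (ball 0 1). f z \<noteq> 0 \<and> \<not> is_pole f z"
    by eventually_elim auto
  then have ev: "\<forall>\<^sub>F w in at z. f w \<noteq> 0 \<and> \<not> is_pole f w" if "z \<in> ball 0 1" for z
    using that by (simp add: eventually_cosparse_open_eq)
  have limpt: "\<not> z islimpt {w \<in> ball 0 r. f w = 0 \<or> is_pole f w}" if z: "z \<in> frontier (ball 0 r)" for z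
  proof -
    have "z \<in> ball 0 1"
      using z r by (cases "r > 0") (auto simp: frontier_ball ball_empty)
    from ev[OF this] have "\<forall>\<^sub>F w in at z. w \<notin> {w \<in> ball 0 r. f w = 0 \<or> is_pole f w}"
      by eventually_elim auto
    then show ?thesis
      by (simp add: islimpt_conv_frequently_at frequently_def)
  qed
  have f_r: "f nicely_meromorphic_on ball 0 r"
    by (rule nicely_meromorphic_on_subset[OF f]) (use r in auto)
  show ?thesis
  proof (rule weierstrass_factorization_meromorphic[OF f_r open_ball connected_ball limpt])
    fix h f1 f2
    assume *: "h holomorphic_on ball 0 r" "f1 holomorphic_on UNIV" "f2 holomorphic_on UNIV"
      "\<forall>z\<in>ball 0 r. f1 z = 0 \<longleftrightarrow> \<not> is_pole f z \<and> f z = 0"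
      "\<forall>z\<in>ball 0 r. f2 z = 0 \<longleftrightarrow> is_pole f z"
      "\<forall>z\<in>ball 0 r. h z \<noteq> 0"
      "\<forall>z\<in>ball 0 r. f z = h z * f1 z / f2 z"
    show ?thesis
    proof (rule that[of "\<lambda>z. h z * f1 z" f2])
      show "(\<lambda>z. h z * f1 z) holomorphic_on ball 0 r" "f2 holomorphic_on ball 0 r"
        using *(1-3) by (auto intro!: holomorphic_intros intro: holomorphic_on_subset)
    qed (use * in auto)
  qed
qed

lemma
  assumes S: "open S" "z \<in> S" and A: "A holomorphic_on S" and P: "P holomorphic_on S"
    and f: "\<And>w. w \<in> S \<Longrightarrow> f w = A w / P w"
  shows not_pole_quotient: "P z \<noteq> 0 \<Longrightarrow> \<not> is_pole f z"
    and is_pole_quotient: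
      "P z = 0 \<Longrightarrow> A z \<noteq> 0 \<Longrightarrow> (\<forall>\<^sub>F w in at z. P w \<noteq> 0) \<Longrightarrow> is_pole f z"
proof -
  have ev: "\<forall>\<^sub>F w in at z. w \<in> S"
    using S by (intro eventually_at_in_open')
  then have "\<forall>\<^sub>F w in at z. f w = A w / P w"
    by eventually_elim (rule f)
  then have cong: "is_pole f z \<longleftrightarrow> is_pole (\<lambda>w. A w / P w) z"
    by (rule is_pole_cong) (rule refl)
  have cont: "isCont A z" "isCont P z"
    using S continuous_on_eq_continuous_at[OF S(1)] A[THEN holomorphic_on_imp_continuous_on]
      P[THEN holomorphic_on_imp_continuous_on] by blast+
  show "\<not> is_pole f z" if "P z \<noteq> 0"
  proof -
    have "(\<lambda>w. A w / P w) \<midarrow>z\<rightarrow> A z / P z"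
      using cont that unfolding isCont_def by (intro tendsto_divide)
    from not_tendsto_and_filterlim_at_infinity[OF at_neq_bot this]
    have "\<not> is_pole (\<lambda>w. A w / P w) z"
      by (auto simp: is_pole_def)
    then show ?thesis by (simp only: cong simp_thms)
  qed
  show "is_pole f z" if "P z = 0" "A z \<noteq> 0" "\<forall>\<^sub>F w in at z. P w \<noteq> 0"
  proof -
    have "filterlim P (at 0) (at z)"
      using cont(2) that(1,3) by (intro filterlim_atI) (simp_all add: isCont_def)
    with cont(1) show ?thesis
      unfolding cong using that(2) by (rule is_pole_divide)
  qed
qed

text \<open>
  The right-hand side is symmetric in \<open>A\<close> and \<open>P\<close> and continuous where they do not vanish
  simultaneously. It is therefore the value at poles too, where \<open>spherical_deriv\<close> is a limit.
\<close>
lemma spherical_deriv_quotient: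
  assumes S: "open S" "z \<in> S" and A: "A holomorphic_on S" and P: "P holomorphic_on S"
    and f: "\<And>w. w \<in> S \<Longrightarrow> f w = A w / P w"
    and AP: "A z \<noteq> 0 \<or> P z \<noteq> 0" and P_ev: "\<forall>\<^sub>F w in at z. P w \<noteq> 0"
  shows "spherical_deriv f z =
           norm (deriv A z * P z - A z * deriv P z) / ((norm (A z))\<^sup>2 + (norm (P z))\<^sup>2)"
proof -
  define W where "W = (\<lambda>w. deriv A w * P w - A w * deriv P w)"
  define Q where "Q = (\<lambda>w. norm (W w) / ((norm (A w))\<^sup>2 + (norm (P w))\<^sup>2))"
  have regular: "norm (deriv f w) / (1 + (norm (f w))\<^sup>2) = Q w" if w: "w \<in> S" "P w \<noteq> 0" for w
  proof -
    have "(A has_field_derivative deriv A w) (at w)" "(P has_field_derivative deriv P w) (at w)"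
      using A P S(1) w(1) by (auto intro: holomorphic_derivI)
    then have "((\<lambda>u. A u / P u) has_field_derivative W w / (P w)\<^sup>2) (at w)"
      using w by (auto intro!: derivative_eq_intros simp: W_def power2_eq_square)
    then have "(f has_field_derivative W w / (P w)\<^sup>2) (at w)"
      by (rule has_field_derivative_transform_within_open[OF _ S(1) w(1)]) (simp add: f)
    then have "deriv f w = W w / (P w)\<^sup>2"
      by (rule DERIV_imp_deriv)
    then have "norm (deriv f w) / (1 + (norm (f w))\<^sup>2)
        = norm (W w) / ((norm (P w))\<^sup>2 * (1 + (norm (A w) / norm (P w))\<^sup>2))"
      using f[OF w(1)] by (simp add: norm_divide norm_power)
    also have "(norm (P w))\<^sup>2 * (1 + (norm (A w) / norm (P w))\<^sup>2) = (norm (A w))\<^sup>2 + (norm (P w))\<^sup>2"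
      using w(2) by (simp add: power_divide field_simps)
    finally show ?thesis by (simp add: Q_def)
  qed
  have "spherical_deriv f z = Q z"
  proof (cases "P z = 0")
    case False
    then show ?thesis
      using not_pole_quotient[OF S A P f] regular S(2) by (simp add: spherical_deriv_def)
  next
    case True
    have pole: "is_pole f z"
      using is_pole_quotient[OF S A P f True] AP True P_ev by blast
    have "\<forall>\<^sub>F w in at z. w \<in> S"
      using S by (intro eventually_at_in_open')
    with P_ev have "\<forall>\<^sub>F w in at z. Q w = norm (deriv f w) / (1 + (norm (f w))\<^sup>2)"
      by eventually_elim (simp add: regular)
    moreover have "Q \<midarrow>z\<rightarrow> Q z"
    proof -
      have "deriv A holomorphic_on S" "deriv P holomorphic_on S"
        using A P S(1) by (auto intro: holomorphic_deriv)
      then have "isCont A z" "isCont P z" "isCont (deriv A) z" "isCont (deriv P) z"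
        using A P S holomorphic_on_imp_continuous_on continuous_on_eq_continuous_at by metis+
      then have "isCont Q z"
        unfolding Q_def W_def using AP
        by (intro continuous_intros) (auto simp: add_nonneg_eq_0_iff)
      then show ?thesis by (simp add: isCont_def)
    qed
    ultimately have "(\<lambda>w. norm (deriv f w) / (1 + (norm (f w))\<^sup>2)) \<midarrow>z\<rightarrow> Q z"
      by (rule Lim_transform_eventually[rotated])
    then show ?thesis
      using pole tendsto_Lim[OF at_neq_bot] by (simp add: spherical_deriv_def)
  qed
  then show ?thesis by (simp add: Q_def W_def)
qed

section \<open>Normalized quotients\<close>

text \<open>
  These are the pairs of solutions of \<open>w'' + (S/2) w = 0\<close> with Wronskian 1 and quotient \<open>f\<close>, where
  \<open>S\<close> is the Schwarzian derivative of \<open>f\<close>. The equation \<open>f z = w1 z / w2 z\<close> holds at poles too, where both sides are 0.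
\<close>
definition normalized_quotient ::
    "(complex \<Rightarrow> complex) \<Rightarrow> complex set \<Rightarrow> (complex \<Rightarrow> complex) \<Rightarrow> (complex \<Rightarrow> complex) \<Rightarrow> bool" where
  "normalized_quotient f S w1 w2 \<longleftrightarrow>
     w1 holomorphic_on S \<and> w2 holomorphic_on S \<and>
     (\<forall>z\<in>S. f z = w1 z / w2 z \<and> deriv w1 z * w2 z - w1 z * deriv w2 z = 1)"

lemma normalized_quotientD:
  assumes "normalized_quotient f S w1 w2"
  shows "w1 holomorphic_on S" "w2 holomorphic_on S"
    and "\<And>z. z \<in> S \<Longrightarrow> f z = w1 z / w2 z"
    and "\<And>z. z \<in> S \<Longrightarrow> deriv w1 z * w2 z - w1 z * deriv w2 z = 1"
  using assms by (auto simp: normalized_quotient_def)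

lemma normalized_quotient_subset:
  "normalized_quotient f S w1 w2 \<Longrightarrow> T \<subseteq> S \<Longrightarrow> normalized_quotient f T w1 w2"
  unfolding normalized_quotient_def using holomorphic_on_subset by blast

text \<open>
  A holomorphic function that vanishes at points arbitrarily close to a zero \<open>z\<close> vanishes near
  \<open>z\<close>, and so does its derivative.
\<close>
lemma holomorphic_eventually_nonzero:
  assumes "w holomorphic_on S" "open S" "z \<in> S" "w z \<noteq> 0 \<or> deriv w z \<noteq> 0"
  shows "\<forall>\<^sub>F u in at z. w u \<noteq> 0"
proof (rule ccontr)
  assume not_ev: "\<not> ?thesis"
  have an: "w analytic_on {z}"
    using assms(1-3) by (rule holomorphic_on_imp_analytic_at)
  then have "w \<midarrow>z\<rightarrow> w z"
    using analytic_at_imp_isCont isContD by blast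
  then have "w z = 0"
    using not_ev tendsto_imp_eventually_ne by blast
  moreover have "\<not> isolated_zero w z"
    using not_ev by (simp add: isolated_zero_def)
  ultimately have "\<forall>\<^sub>F u in nhds z. w u = 0"
    by (rule non_isolated_zero_imp_eventually_zero'[OF an])
  then have "deriv w z = deriv (\<lambda>_. 0) z"
    by (rule deriv_cong_ev) (rule refl)
  then show False
    using assms(4) \<open>w z = 0\<close> by simp
qed

lemma normalized_quotient_eventually_nonzero:
  assumes "normalized_quotient f S w1 w2" "open S" "z \<in> S"
  shows "\<forall>\<^sub>F u in at z. w2 u \<noteq> 0"
  using normalized_quotientD(4)[OF assms(1,3)]
  by (intro holomorphic_eventually_nonzero[OF normalized_quotientD(2)[OF assms(1)] assms(2,3)]) auto

text \<open>
  A lower bound for the spherical derivative of \<open>f\<close> thus becomes an upper bound for a sum of squares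
  of moduli of holomorphic functions.
\<close>
lemma spherical_deriv_normalized_quotient:
  assumes w: "normalized_quotient f S w1 w2" and S: "open S" "z \<in> S"
  shows "spherical_deriv f z = 1 / ((norm (w1 z))\<^sup>2 + (norm (w2 z))\<^sup>2)"
proof -
  note D = normalized_quotientD[OF w]
  have "w1 z \<noteq> 0 \<or> w2 z \<noteq> 0"
    using D(4)[OF S(2)] by auto
  from spherical_deriv_quotient[OF S D(1,2,3) this normalized_quotient_eventually_nonzero[OF w S]]
  show ?thesis
    by (simp add: D(4)[OF S(2)])
qed

lemma normalized_quotient_pole_iff:
  assumes w: "normalized_quotient f S w1 w2" and S: "open S" "z \<in> S"
  shows "is_pole f z \<longleftrightarrow> w2 z = 0"
proof -
  note D = normalized_quotientD[OF w]
  have "w1 z \<noteq> 0" if "w2 z = 0"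
    using D(4)[OF S(2)] that by auto
  then show ?thesis
    using not_pole_quotient[OF S D(1,2,3)] is_pole_quotient[OF S D(1,2,3)]
      normalized_quotient_eventually_nonzero[OF w S] by blast
qed

text \<open>
  Write \<open>f = A / P\<close>. By \<open>spherical_deriv_quotient\<close>, positivity of the spherical derivative says that
  the Wronskian of \<open>A\<close> and \<open>P\<close> has no zeros, so that it has a holomorphic square root \<open>h\<close>. Dividing
  \<open>A\<close> and \<open>P\<close> by \<open>h\<close> divides the Wronskian by \<open>h\<^sup>2\<close>.
\<close>
lemma normalized_quotient_exists:
  assumes f: "f nicely_meromorphic_on ball 0 1" and r: "r < 1"
    and pos: "\<And>z. z \<in> ball 0 1 \<Longrightarrow> spherical_deriv f z > 0"
  obtains w1 w2 where "normalized_quotient f (ball 0 r) w1 w2"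
proof -
  let ?S = "ball 0 r :: complex set"
  obtain A P where A: "A holomorphic_on ?S" and P: "P holomorphic_on ?S"
    and fAP: "\<And>z. z \<in> ?S \<Longrightarrow> f z = A z / P z"
    and AP: "\<And>z. z \<in> ?S \<Longrightarrow> A z \<noteq> 0 \<or> P z \<noteq> 0"
    and pole: "\<And>z. z \<in> ?S \<Longrightarrow> P z = 0 \<longleftrightarrow> is_pole f z"
    using nicely_meromorphic_quotient_on_smaller_disc[OF f r] by metis
  define W where "W = (\<lambda>z. deriv A z * P z - A z * deriv P z)"
  have W_hol: "W holomorphic_on ?S"
    unfolding W_def by (intro holomorphic_intros A P open_ball)
  have W_nz: "W z \<noteq> 0" if z: "z \<in> ?S" for z
  proof -
    have z1: "z \<in> ball 0 1" using z r by auto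
    have "\<forall>\<^sub>F w in cosparse (ball 0 1). \<not> is_pole f w"
      using f by (intro meromorphic_on_imp_not_pole_cosparse) (simp add: nicely_meromorphic_on_def)
    then have "\<forall>\<^sub>F w in at z. \<not> is_pole f w"
      using z1 by (simp add: eventually_cosparse_open_eq)
    moreover have "\<forall>\<^sub>F w in at z. w \<in> ?S"
      using z by (intro eventually_at_in_open') auto
    ultimately have "\<forall>\<^sub>F w in at z. P w \<noteq> 0"
      by eventually_elim (simp add: pole)
    from spherical_deriv_quotient[OF open_ball z A P fAP AP[OF z] this] pos[OF z1]
    show ?thesis by (auto simp: W_def)
  qed
  have "simply_connected ?S"
    by (intro convex_imp_simply_connected convex_ball)
  then obtain h where h: "h holomorphic_on ?S" "\<And>z. z \<in> ?S \<Longrightarrow> W z = (h z)\<^sup>2"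
    using simply_connected_eq_holomorphic_sqrt[OF open_ball, of 0 r] W_hol W_nz by metis
  have h_nz: "h z \<noteq> 0" if "z \<in> ?S" for z
    using W_nz[OF that] h(2)[OF that] by auto
  have "normalized_quotient f ?S (\<lambda>z. A z / h z) (\<lambda>z. P z / h z)"
    unfolding normalized_quotient_def
  proof (intro conjI ballI)
    fix z assume z: "z \<in> ?S"
    show "f z = A z / h z / (P z / h z)"
      using fAP[OF z] h_nz[OF z] by simp
    have diff: "A field_differentiable at z" "P field_differentiable at z" "h field_differentiable at z"
      using A P h(1) z by (auto intro: holomorphic_on_imp_differentiable_at)
    have quot: "deriv (\<lambda>z. A z / h z) z = (deriv A z * h z - A z * deriv h z) / (h z)\<^sup>2"
      "deriv (\<lambda>z. P z / h z) z = (deriv P z * h z - P z * deriv h z) / (h z)\<^sup>2"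
      using diff h_nz[OF z] by (simp_all add: deriv_divide)
    have "deriv (\<lambda>z. A z / h z) z * (P z / h z) - A z / h z * deriv (\<lambda>z. P z / h z) z
        = W z / (h z)\<^sup>2"
      unfolding quot using h_nz[OF z] by (simp add: W_def field_simps power2_eq_square)
    then show "deriv (\<lambda>z. A z / h z) z * (P z / h z) - A z / h z * deriv (\<lambda>z. P z / h z) z = 1"
      using h(2)[OF z] h_nz[OF z] by simp
  qed (use A P h_nz h(1) in \<open>auto intro!: holomorphic_intros\<close>)
  then show ?thesis by (rule that)
qed

text \<open>
  Two normalized pairs with the same quotient differ by a common holomorphic factor; since both
  Wronskians are 1, the square of this factor is 1, and a continuous sign is constant.
\<close>
lemma normalized_quotient_unique:
  assumes w: "normalized_quotient f S w1 w2" and v: "normalized_quotient f S v1 v2"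
    and S: "open S" "connected S"
  obtains \<epsilon> where "\<epsilon> = 1 \<or> \<epsilon> = -1" "\<And>z. z \<in> S \<Longrightarrow> v1 z = \<epsilon> * w1 z" "\<And>z. z \<in> S \<Longrightarrow> v2 z = \<epsilon> * w2 z"
proof -
  note W = normalized_quotientD[OF w] and V = normalized_quotientD[OF v]
  \<comment> \<open>At a pole of \<open>f\<close> both denominators vanish.\<close>
  have cross: "w1 z * v2 z = v1 z * w2 z" if z: "z \<in> S" for z
    using W(3)[OF z] V(3)[OF z] normalized_quotient_pole_iff[OF w S(1) z]
      normalized_quotient_pole_iff[OF v S(1) z]
    by (cases "w2 z = 0") (auto simp: field_simps)
  \<comment> \<open>Multiply the Wronskians by \<open>v2\<^sup>2\<close> and \<open>w2\<^sup>2\<close> and use \<open>cross\<close> together with its derivative \<open>d\<close>.\<close>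
  have sq: "(v2 z)\<^sup>2 = (w2 z)\<^sup>2" if z: "z \<in> S" for z
  proof -
    have D: "(w1 has_field_derivative deriv w1 z) (at z)" "(w2 has_field_derivative deriv w2 z) (at z)"
      "(v1 has_field_derivative deriv v1 z) (at z)" "(v2 has_field_derivative deriv v2 z) (at z)"
      using W(1,2) V(1,2) S(1) z by (auto intro: holomorphic_derivI)
    have "((\<lambda>z. w1 z * v2 z) has_field_derivative deriv v1 z * w2 z + deriv w2 z * v1 z) (at z)"
      by (rule has_field_derivative_transform_within_open[OF DERIV_mult[OF D(3,2)] S(1) z])
         (simp add: cross)
    then have d: "deriv w1 z * v2 z + deriv v2 z * w1 z = deriv v1 z * w2 z + deriv w2 z * v1 z"
      using DERIV_mult[OF D(1,4)] DERIV_unique by blast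
    have "(v2 z)\<^sup>2 - (w2 z)\<^sup>2
        = (v2 z)\<^sup>2 * (deriv w1 z * w2 z - w1 z * deriv w2 z) - (w2 z)\<^sup>2 * (deriv v1 z * v2 z - v1 z * deriv v2 z)"
      by (simp add: W(4)[OF z] V(4)[OF z])
    also have "\<dots> = w2 z * v2 z * ((deriv w1 z * v2 z + deriv v2 z * w1 z) - (deriv v1 z * w2 z + deriv w2 z * v1 z))
        - (w1 z * v2 z - v1 z * w2 z) * (v2 z * deriv w2 z + w2 z * deriv v2 z)"
      by (simp add: power2_eq_square algebra_simps)
    also have "\<dots> = 0"
      by (simp add: cross[OF z] d)
    finally show ?thesis by simp
  qed
  have "(\<forall>z\<in>S. v2 z - w2 z = 0) \<or> (\<forall>z\<in>S. v2 z + w2 z = 0)"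
    using sq by (intro holomorphic_mult_eq_0 S holomorphic_intros W V)
       (simp add: power2_eq_square algebra_simps)
  then obtain \<epsilon> :: complex where \<epsilon>: "\<epsilon> = 1 \<or> \<epsilon> = -1" and v2: "\<And>z. z \<in> S \<Longrightarrow> v2 z = \<epsilon> * w2 z"
    by (metis add.inverse_inverse add_eq_0_iff mult_1 mult_minus1 right_minus_eq)
  have "(\<forall>z\<in>S. v1 z - \<epsilon> * w1 z = 0) \<or> (\<forall>z\<in>S. w2 z = 0)"
  proof (intro holomorphic_mult_eq_0 S holomorphic_intros W V)
    fix z assume z: "z \<in> S"
    show "(v1 z - \<epsilon> * w1 z) * w2 z = 0"
    proof -
      have "(v1 z - \<epsilon> * w1 z) * w2 z = w1 z * v2 z - \<epsilon> * w1 z * w2 z"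
        using cross[OF z] by (simp add: left_diff_distrib)
      then show ?thesis
        by (simp add: v2[OF z])
    qed
  qed
  moreover have False if "\<forall>z\<in>S. w2 z = 0" "z \<in> S" for z
  proof -
    have "\<forall>\<^sub>F u in at z. u \<in> S"
      using S(1) that(2) by (intro eventually_at_in_open')
    with normalized_quotient_eventually_nonzero[OF w S(1) that(2)] have "\<forall>\<^sub>F u in at z. False"
      by eventually_elim (use that(1) in auto)
    then show False by simp
  qed
  ultimately have "v1 z = \<epsilon> * w1 z" if "z \<in> S" for z
    using that by auto
  with \<epsilon> v2 show ?thesis by (intro that[of \<epsilon>]) auto
qed

section \<open>Two by two unitary matrices\<close>

text \<open>
  The Cauchy-Schwarz inequality with its error term, which is needed for the case of equality.
\<close>
lemma lagrange_identity_complex: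
  fixes a b c d :: complex
  shows "(norm (a * d - b * c))\<^sup>2 + (norm (cnj a * b + cnj c * d))\<^sup>2
    = ((norm a)\<^sup>2 + (norm c)\<^sup>2) * ((norm b)\<^sup>2 + (norm d)\<^sup>2)"
  unfolding cmod_power2 by (simp add: power2_eq_square algebra_simps)

lemma unitary_matrix_2_iff:
  "unitary_matrix (vector [vector [a, b], vector [c, d]] :: complex^2^2) \<longleftrightarrow>
     (norm a)\<^sup>2 + (norm c)\<^sup>2 = 1 \<and> (norm b)\<^sup>2 + (norm d)\<^sup>2 = 1 \<and> cnj a * b + cnj c * d = 0"
proof -
  let ?M = "vector [vector [a, b], vector [c, d]] :: complex^2^2"
  have sq: "cnj x * x + cnj y * y = of_real ((norm x)\<^sup>2 + (norm y)\<^sup>2)" for x y :: complex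
    by (simp only: of_real_add complex_norm_square mult.commute)
  have "conj_transpose ?M ** ?M = mat 1 \<longleftrightarrow>
      cnj a * a + cnj c * c = 1 \<and> cnj a * b + cnj c * d = 0 \<and>
      cnj b * a + cnj d * c = 0 \<and> cnj b * b + cnj d * d = 1"
    by (simp add: vec_eq_iff forall_2 matrix_matrix_mult_def conj_transpose_def mat_def sum_2)
  also have "cnj a * a + cnj c * c = 1 \<longleftrightarrow> (norm a)\<^sup>2 + (norm c)\<^sup>2 = 1"
    by (simp only: sq of_real_eq_1_iff)
  also have "cnj b * b + cnj d * d = 1 \<longleftrightarrow> (norm b)\<^sup>2 + (norm d)\<^sup>2 = 1"
    by (simp only: sq of_real_eq_1_iff)
  also have "cnj b * a + cnj d * c = 0 \<longleftrightarrow> cnj a * b + cnj c * d = 0"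
  proof -
    have "cnj b * a + cnj d * c = cnj (cnj a * b + cnj c * d)" by simp
    then show ?thesis by (simp only: complex_cnj_zero_iff)
  qed
  finally have "conj_transpose ?M ** ?M = mat 1 \<longleftrightarrow>
      (norm a)\<^sup>2 + (norm c)\<^sup>2 = 1 \<and> (norm b)\<^sup>2 + (norm d)\<^sup>2 = 1 \<and> cnj a * b + cnj c * d = 0"
    by blast
  moreover have "?M ** conj_transpose ?M = mat 1 \<longleftrightarrow> conj_transpose ?M ** ?M = mat 1"
    by (rule matrix_left_right_inverse)
  ultimately show ?thesis
    unfolding unitary_matrix_def by blast
qed

section \<open>The upper bound\<close>

text \<open>
  The function \<open>|w1|\<^sup>2 + |w2|\<^sup>2\<close> is at most \<open>1 / c\<close> pointwise, hence also in the mean over the circle of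
  radius \<open>s\<close>, to which Bessel's inequality applies.
\<close>
lemma normalized_quotient_taylor_bound:
  assumes w: "normalized_quotient f (ball 0 r) w1 w2" and s: "0 < s" "s < r" and J: "finite J"
    and c: "c > 0" "\<And>z. z \<in> ball 0 r \<Longrightarrow> c \<le> spherical_deriv f z"
  shows "(\<Sum>j\<in>J. ((norm (taylor_coeff w1 j))\<^sup>2 + (norm (taylor_coeff w2 j))\<^sup>2) * s ^ (2 * j)) \<le> 1 / c"
proof -
  note D = normalized_quotientD[OF w]
  let ?I = "\<lambda>w t. (norm (w (of_real s * cis (2 * pi * t)) :: complex))\<^sup>2"
  have int: "?I w1 integrable_on {0..1}" "?I w2 integrable_on {0..1}"
    using integrable_norm_power2_circle s D(1,2) by blast+
  have bound: "?I w1 t + ?I w2 t \<le> 1 / c" for t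
  proof -
    let ?z = "of_real s * cis (2 * pi * t)"
    have z: "?z \<in> ball 0 r" using s by (simp add: norm_mult)
    have "w1 ?z \<noteq> 0 \<or> w2 ?z \<noteq> 0"
      using D(4)[OF z] by auto
    then have "(norm (w1 ?z))\<^sup>2 + (norm (w2 ?z))\<^sup>2 > 0"
      by (auto simp: add_pos_nonneg add_nonneg_pos)
    then show ?thesis
      using c(2)[OF z] c(1) spherical_deriv_normalized_quotient[OF w open_ball z]
      by (simp add: field_simps)
  qed
  have "(\<Sum>j\<in>J. ((norm (taylor_coeff w1 j))\<^sup>2 + (norm (taylor_coeff w2 j))\<^sup>2) * s ^ (2 * j))
      \<le> integral {0..1} (?I w1) + integral {0..1} (?I w2)"
    using bessel_inequality_circle[OF D(1) s J] bessel_inequality_circle[OF D(2) s J]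
    by (simp add: distrib_right sum.distrib)
  also have "\<dots> = integral {0..1} (\<lambda>t. ?I w1 t + ?I w2 t)"
    using int by (simp add: integral_add)
  also have "\<dots> \<le> integral {0..1::real} (\<lambda>_. 1 / c)"
    by (intro integral_le integrable_add int bound integrable_const_ivl)
  finally show ?thesis by simp
qed

lemma normalized_quotient_det_at_0:
  assumes "normalized_quotient f S w1 w2" "0 \<in> S"
  shows "taylor_coeff w1 1 * taylor_coeff w2 0 - taylor_coeff w1 0 * taylor_coeff w2 1 = 1"
  using normalized_quotientD(4)[OF assms] by (simp add: taylor_coeff_def)

text \<open>
  The Cauchy-Schwarz inequality, applied to the Wronskian at 0.
\<close>
lemma normalized_quotient_gram:
  assumes "normalized_quotient f S w1 w2" "0 \<in> S"
  shows "1 \<le> ((norm (taylor_coeff w1 0))\<^sup>2 + (norm (taylor_coeff w2 0))\<^sup>2) *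
             ((norm (taylor_coeff w1 1))\<^sup>2 + (norm (taylor_coeff w2 1))\<^sup>2)"
proof -
  have "1 = (norm (taylor_coeff w1 1 * taylor_coeff w2 0 - taylor_coeff w1 0 * taylor_coeff w2 1))\<^sup>2"
    unfolding normalized_quotient_det_at_0[OF assms] by simp
  also have "\<dots> \<le> ((norm (taylor_coeff w1 1))\<^sup>2 + (norm (taylor_coeff w2 1))\<^sup>2) *
      ((norm (taylor_coeff w1 0))\<^sup>2 + (norm (taylor_coeff w2 0))\<^sup>2)"
    unfolding lagrange_identity_complex[symmetric] by simp
  finally show ?thesis by (simp add: mult.commute)
qed

text \<open>
  Keep only the coefficients of order 0 and 1 in \<open>normalized_quotient_taylor_bound\<close>. Writing \<open>X\<close> and
  \<open>Y\<close> for the sums of their squared moduli, \<open>X Y \<ge> 1\<close> and the inequality of the means give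
  \<open>2 s \<le> X + s\<^sup>2 Y \<le> 1 / c\<close> for all \<open>s < 1\<close>.
\<close>
lemma spherical_deriv_lower_bound_le:
  assumes f: "f nicely_meromorphic_on ball 0 1"
    and c: "c > 0" "\<And>z. z \<in> ball 0 1 \<Longrightarrow> c \<le> spherical_deriv f z"
  shows "c \<le> 1 / 2"
proof -
  have pos: "spherical_deriv f z > 0" if "z \<in> ball 0 1" for z
    using c(1) c(2)[OF that] by simp
  have "s * 2 \<le> 1 / c" if s: "0 < s" "s < 1" for s :: real
  proof -
    define r where "r = (1 + s) / 2"
    have r: "s < r" "r < 1" using s by (auto simp: r_def)
    obtain w1 w2 where w: "normalized_quotient f (ball 0 r) w1 w2"
      using normalized_quotient_exists[OF f r(2) pos] by blast
    define X where "X = (norm (taylor_coeff w1 0))\<^sup>2 + (norm (taylor_coeff w2 0))\<^sup>2"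
    define Y where "Y = (norm (taylor_coeff w1 1))\<^sup>2 + (norm (taylor_coeff w2 1))\<^sup>2"
    have XY: "1 \<le> X * Y"
      using normalized_quotient_gram[OF w] s r by (simp add: X_def Y_def)
    have nonneg: "X \<ge> 0" "Y \<ge> 0" by (simp_all add: X_def Y_def)
    have "(\<Sum>j\<in>{0,1}. ((norm (taylor_coeff w1 j))\<^sup>2 + (norm (taylor_coeff w2 j))\<^sup>2) * s ^ (2 * j)) \<le> 1 / c"
      using r by (intro normalized_quotient_taylor_bound[OF w s(1) r(1)] c) auto
    then have "X + s\<^sup>2 * Y \<le> 1 / c"
      by (simp add: X_def Y_def mult.commute)
    moreover have "2 * s \<le> X + s\<^sup>2 * Y"
    proof (rule power2_le_imp_le)
      have "(2 * s)\<^sup>2 \<le> 4 * s\<^sup>2 * (X * Y)"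
        using mult_left_mono[OF XY, of "4 * s\<^sup>2"] by (simp add: power_mult_distrib)
      also have "\<dots> \<le> 4 * s\<^sup>2 * (X * Y) + (X - s\<^sup>2 * Y)\<^sup>2"
        by simp
      also have "\<dots> = (X + s\<^sup>2 * Y)\<^sup>2"
        by (simp add: power2_eq_square algebra_simps)
      finally show "(2 * s)\<^sup>2 \<le> (X + s\<^sup>2 * Y)\<^sup>2" .
    qed (use nonneg in auto)
    ultimately show ?thesis by simp
  qed
  then have "2 \<le> 1 / c"
    by (rule field_le_mult_one_interval)
  then show ?thesis
    using c(1) by (simp add: field_simps)
qed

section \<open>The extremal functions\<close>

text \<open>
  With \<open>1 / c = 2\<close> the estimates leave no room: in the limit \<open>s \<rightarrow> 1\<close> the squared moduli \<open>N j\<close> of the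
  coefficients sum to at most 2, while those of order 0 and 1 alone contribute at least 2. So all
  coefficients of higher order vanish, \<open>f\<close> is a quotient of affine functions, and equality in the
  Cauchy-Schwarz inequality says that the matrix of its coefficients is unitary.

  The normalized quotient comes from \<open>normalized_quotient_exists\<close> and thus depends on the radius
  \<open>r < 1\<close> of the disc on which it lives. By \<open>normalized_quotient_unique\<close> its
  coefficients do not depend on \<open>r\<close> up to a sign, so those of one fixed pair, on the disc of
  radius \<open>1/2\<close>, satisfy the bounds for all \<open>s < 1\<close>.
\<close>
lemma rigid_motion_if_spherical_deriv_ge_half:
  assumes f: "f nicely_meromorphic_on ball 0 1"
    and ge: "\<And>z. z \<in> ball 0 1 \<Longrightarrow> 1 / 2 \<le> spherical_deriv f z"
  shows "\<exists>T. rigid_motion T \<and> (\<forall>z\<in>ball 0 1. f z = T z)"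
proof -
  have pos: "spherical_deriv f z > 0" if "z \<in> ball 0 1" for z
    using ge[OF that] by simp
  obtain w1 w2 where w: "normalized_quotient f (ball 0 (1/2)) w1 w2"
    using normalized_quotient_exists[OF f _ pos, of "1/2"] by auto
  define a where "a = taylor_coeff w1"
  define b where "b = taylor_coeff w2"
  have lift: "\<exists>v1 v2 \<epsilon>. normalized_quotient f (ball 0 r) v1 v2 \<and> (\<epsilon> = 1 \<or> \<epsilon> = -1) \<and>
      (\<forall>n. taylor_coeff v1 n = \<epsilon> * a n) \<and> (\<forall>n. taylor_coeff v2 n = \<epsilon> * b n)"
    if r: "1/2 \<le> r" "r < 1" for r
  proof -
    obtain v1 v2 where v: "normalized_quotient f (ball 0 r) v1 v2"
      using normalized_quotient_exists[OF f r(2) pos] by auto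
    then have "normalized_quotient f (ball 0 (1/2)) v1 v2"
      by (rule normalized_quotient_subset) (use r in auto)
    from normalized_quotient_unique[OF w this open_ball connected_ball]
    obtain \<epsilon> where \<epsilon>: "\<epsilon> = 1 \<or> \<epsilon> = -1" "\<And>z. z \<in> ball 0 (1/2) \<Longrightarrow> v1 z = \<epsilon> * w1 z"
      "\<And>z. z \<in> ball 0 (1/2) \<Longrightarrow> v2 z = \<epsilon> * w2 z"
      by blast
    have "taylor_coeff v1 n = \<epsilon> * a n" "taylor_coeff v2 n = \<epsilon> * b n" for n
      unfolding a_def b_def
      using taylor_coeff_cong_cmult[OF _ normalized_quotientD(1)[OF w] \<epsilon>(2)]
        taylor_coeff_cong_cmult[OF _ normalized_quotientD(2)[OF w] \<epsilon>(3)] by simp_all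
    then show ?thesis using v \<epsilon>(1) by blast
  qed
  define N where "N = (\<lambda>n. (norm (a n))\<^sup>2 + (norm (b n))\<^sup>2)"
  have N_nonneg: "N n \<ge> 0" for n by (simp add: N_def)
  have sum_N: "(\<Sum>j\<in>J. N j) \<le> 2" if J: "finite J" for J
  proof -
    have le: "(\<Sum>j\<in>J. N j * s ^ (2 * j)) \<le> 2" if s: "0 < s" "s < 1" for s
    proof -
      define r where "r = (1 + s) / 2"
      have r: "1/2 \<le> r" "r < 1" "s < r" using s by (auto simp: r_def)
      obtain v1 v2 \<epsilon> where v: "normalized_quotient f (ball 0 r) v1 v2" "\<epsilon> = 1 \<or> \<epsilon> = -1"
        "\<And>n. taylor_coeff v1 n = \<epsilon> * a n" "\<And>n. taylor_coeff v2 n = \<epsilon> * b n"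
        using lift[OF r(1,2)] by blast
      have "(\<Sum>j\<in>J. ((norm (taylor_coeff v1 j))\<^sup>2 + (norm (taylor_coeff v2 j))\<^sup>2) * s ^ (2 * j)) \<le> 1 / (1/2)"
        using r by (intro normalized_quotient_taylor_bound[OF v(1) s(1) r(3) J] ge) auto
      then show ?thesis
        using v(2) by (auto simp: v(3,4) N_def norm_mult)
    qed
    have "((\<lambda>s. \<Sum>j\<in>J. N j * s ^ (2 * j)) \<longlongrightarrow> (\<Sum>j\<in>J. N j * 1 ^ (2 * j))) (at_left (1::real))"
      by (intro tendsto_intros)
    then have "(\<Sum>j\<in>J. N j * 1 ^ (2 * j)) \<le> 2"
    proof (rule tendsto_upperbound)
      have "\<forall>\<^sub>F s in at_left (1::real). s \<in> {0<..<1}"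
        by (intro eventually_at_left_real) auto
      then show "\<forall>\<^sub>F s in at_left 1. (\<Sum>j\<in>J. N j * s ^ (2 * j)) \<le> 2"
        by eventually_elim (use le in auto)
    qed auto
    then show ?thesis by simp
  qed
  have N01: "1 \<le> N 0 * N 1"
    using normalized_quotient_gram[OF w] by (simp add: N_def a_def b_def)
  have sum2: "N 0 + N 1 \<ge> 2"
  proof (rule power2_le_imp_le)
    show "2\<^sup>2 \<le> (N 0 + N 1)\<^sup>2"
      using N01 zero_le_power2[of "N 0 - N 1"] by (simp add: power2_eq_square algebra_simps)
  qed (use N_nonneg in auto)
  have N_eq: "N 0 + N 1 = 2"
    using sum2 sum_N[of "{0,1}"] by simp
  then have "(N 0 - N 1)\<^sup>2 \<le> 0"
    using N01 power2_sum[of "N 0" "N 1"] power2_diff[of "N 0" "N 1"] by simp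
  then have N1: "N 0 = 1" "N 1 = 1"
    using N_eq by auto
  have high: "a n = 0" "b n = 0" if "n \<ge> 2" for n
  proof -
    have "N n \<le> 0"
      using sum_N[of "{0,1,n}"] that N_eq by simp
    then show "a n = 0" "b n = 0"
      by (auto simp: N_def sum_power2_le_zero_iff)
  qed
  have det: "a 1 * b 0 - a 0 * b 1 = 1"
    using normalized_quotient_det_at_0[OF w] by (simp add: a_def b_def)
  have "cnj (a 1) * a 0 + cnj (b 1) * b 0 = 0"
    using lagrange_identity_complex[of "a 1" "b 0" "a 0" "b 1"] N1 det by (simp add: N_def)
  then have "unitary_matrix (vector [vector [a 1, a 0], vector [b 1, b 0]] :: complex^2^2)"
    unfolding unitary_matrix_2_iff using N1 by (simp add: N_def)
  then have "rigid_motion (\<lambda>z. (a 1 * z + a 0) / (b 1 * z + b 0))"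
    unfolding rigid_motion_def by blast
  moreover have "f z = (a 1 * z + a 0) / (b 1 * z + b 0)" if z: "z \<in> ball 0 1" for z
  proof -
    define r where "r = (1 + norm z) / 2"
    have r: "1/2 \<le> r" "r < 1" and zr: "z \<in> ball 0 r" using z by (auto simp: r_def)
    obtain v1 v2 \<epsilon> where v: "normalized_quotient f (ball 0 r) v1 v2" "\<epsilon> = 1 \<or> \<epsilon> = -1"
      "\<And>n. taylor_coeff v1 n = \<epsilon> * a n" "\<And>n. taylor_coeff v2 n = \<epsilon> * b n"
      using lift[OF r] by blast
    note V = normalized_quotientD[OF v(1)]
    have "v1 z = \<epsilon> * (a 1 * z + a 0)"
      using holomorphic_eq_affine[OF V(1) zr] by (simp add: v(3) high algebra_simps)
    moreover have "v2 z = \<epsilon> * (b 1 * z + b 0)"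
      using holomorphic_eq_affine[OF V(2) zr] by (simp add: v(4) high algebra_simps)
    ultimately show ?thesis
      using V(3)[OF zr] v(2) by auto
  qed
  ultimately show ?thesis
    by (intro exI[of _ "\<lambda>z. (a 1 * z + a 0) / (b 1 * z + b 0)"]) simp
qed

text \<open>
  For \<open>A z = a z + b\<close> and \<open>P z = c z + d\<close> the Wronskian is the determinant, of modulus 1, and
  \<open>|A z|\<^sup>2 + |P z|\<^sup>2 = |z|\<^sup>2 + 1\<close> because a unitary matrix preserves the norm of the vector \<open>(z, 1)\<close>.
\<close>
lemma spherical_deriv_rigid_motion:
  assumes T: "rigid_motion T" and S: "open S" "z \<in> S" and f: "\<And>w. w \<in> S \<Longrightarrow> f w = T w"
  shows "spherical_deriv f z = 1 / (1 + (norm z)\<^sup>2)"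
proof -
  obtain a b c d where unit: "(norm a)\<^sup>2 + (norm c)\<^sup>2 = 1" "(norm b)\<^sup>2 + (norm d)\<^sup>2 = 1"
      "cnj a * b + cnj c * d = 0"
    and T: "\<And>z. T z = (a * z + b) / (c * z + d)"
    using T unfolding rigid_motion_def unitary_matrix_2_iff by blast
  have det: "norm (a * d - b * c) = 1"
    using lagrange_identity_complex[of a d b c] unit by (simp add: abs_square_eq_1)
  have deriv: "deriv (\<lambda>z. a * z + b) z = a" "deriv (\<lambda>z. c * z + d) z = c"
    by (auto intro!: DERIV_imp_deriv derivative_eq_intros)
  have W: "a * (c * z + d) - (a * z + b) * c = a * d - b * c"
    by (simp add: algebra_simps)
  have nz: "a * z + b \<noteq> 0 \<or> c * z + d \<noteq> 0"
    using W det by auto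
  have "\<forall>\<^sub>F w in at z. c * w + d \<noteq> 0"
    using det deriv(2) S
    by (intro holomorphic_eventually_nonzero[of _ S]) (auto intro!: holomorphic_intros)
  then have "spherical_deriv f z =
      norm (a * (c * z + d) - (a * z + b) * c) / ((norm (a * z + b))\<^sup>2 + (norm (c * z + d))\<^sup>2)"
    using spherical_deriv_quotient[OF S, of "\<lambda>z. a * z + b" "\<lambda>z. c * z + d" f] nz
    by (simp add: f T deriv holomorphic_intros)
  also have "norm (a * (c * z + d) - (a * z + b) * c) = 1"
    unfolding W by (rule det)
  also have "(norm (a * z + b))\<^sup>2 + (norm (c * z + d))\<^sup>2 = 1 + (norm z)\<^sup>2"
  proof -
    have "(norm (a * z + b))\<^sup>2 + (norm (c * z + d))\<^sup>2
        = ((norm a)\<^sup>2 + (norm c)\<^sup>2) * (norm z)\<^sup>2 + ((norm b)\<^sup>2 + (norm d)\<^sup>2)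
          + 2 * Re (cnj z * (cnj a * b + cnj c * d))"
      unfolding cmod_power2 by (simp add: power2_eq_square algebra_simps)
    then show ?thesis by (simp add: unit)
  qed
  finally show ?thesis .
qed

theorem theorem3:
  fixes f :: "complex \<Rightarrow> complex"
  assumes "f nicely_meromorphic_on ball 0 1"
  shows "(INF z\<in>ball 0 1. spherical_deriv f z) \<le> 1 / 2 \<and>
         ((INF z\<in>ball 0 1. spherical_deriv f z) = 1 / 2 \<longleftrightarrow>
           (\<exists>T. rigid_motion T \<and> (\<forall>z\<in>ball 0 1. f z = T z)))"
proof -
  let ?m = "INF z\<in>ball 0 1. spherical_deriv f z"
  have "bdd_below (spherical_deriv f ` ball 0 1)"
    using spherical_deriv_nonneg nicely_meromorphic_on_subset[OF assms]
    by (intro bdd_belowI[of _ 0]) auto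
  then have lower: "?m \<le> spherical_deriv f z" if "z \<in> ball 0 1" for z
    using that by (rule cINF_lower)
  have le: "?m \<le> 1 / 2"
  proof (cases "?m > 0")
    case True
    then show ?thesis
      using spherical_deriv_lower_bound_le[OF assms _ lower] by blast
  qed simp
  moreover have "\<exists>T. rigid_motion T \<and> (\<forall>z\<in>ball 0 1. f z = T z)" if "?m = 1 / 2"
  proof -
    have "1 / 2 \<le> spherical_deriv f z" if "z \<in> ball 0 1" for z
      using lower[OF that] \<open>?m = 1 / 2\<close> by simp
    with assms show ?thesis
      by (rule rigid_motion_if_spherical_deriv_ge_half)
  qed
  moreover have "?m = 1 / 2" if T: "rigid_motion T" "\<forall>z\<in>ball 0 1. f z = T z" for T
  proof (rule antisym[OF le])
    have "1 / 2 \<le> spherical_deriv f z" if z: "z \<in> ball 0 1" for z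
    proof -
      have "(norm z)\<^sup>2 \<le> 1"
        using z by (simp add: power_le_one)
      then have "1 / 2 \<le> 1 / (1 + (norm z)\<^sup>2)"
        by (intro divide_left_mono) (auto simp: add_pos_nonneg)
      then show ?thesis
        using spherical_deriv_rigid_motion[OF T(1) open_ball z] T(2) by simp
    qed
    then show "1 / 2 \<le> ?m"
      by (intro cINF_greatest) auto
  qed
  ultimately show ?thesis by blast
qed

end
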